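(* Let $A$ be a real $q\times p$ matrix, let $\widehat{A\beta^{*}}$ be a preliminary estimator of $A\beta^{*}$ (a random vector in $\mathbb{R}^q$), let $\kappa>0$ and $\eta\in(0,1)$. Assume: (i) there is a constant $c(A,3)>0$ such that for every $\alpha\in\mathbb{R}^p$ with $\sum_{j:\beta^*_j=0}|\alpha_j|\le 3\sum_{j:\beta^*_j\neq 0}|\alpha_j|$ one has $$\alpha'(A'A)\alpha \ \ge\ c(A,3)\, n \sum_{j:\beta^*_j\neq 0}\alpha_j^2 ;$$ (ii) with probability at least $1-\eta$, $$\left\|A'(\widehat{A\beta^{*}}-A\beta^* )\right\|_\infty\le \kappa\sigma\sqrt{2n\log\frac{p}{\eta}} .$$ Choose $\lambda=2\kappa\sigma\sqrt{2n\log\left(\frac{p}{\eta}\right)}$ and let $$\hat\beta_{A,\lambda}\in\arg\min_{\beta\in\mathbb{R}^p}\left\{\left\|\widehat{A\beta^*}-A\beta\right\|_2^2+2\lambda\|\beta\|_1\right\}.$$ Then, with probability at least $1-\eta$, we have simultaneously $$\left\|A(\hat\beta_{A,\lambda}-\beta^* )\right\|_2^2\le \frac{72\,\sigma^2\kappa^2\|\beta^*\|_0}{c(A,3)}\log\left(\frac{p}{\eta}\right)$$ and $$\left\|\beta^*-\hat\beta_{A,\lambda}\right\|_1\le \frac{24\sqrt2\,\kappa\sigma\|\beta^*\|_0}{c(A,3)}\sqrt{\frac{\log(p/\eta)}{n}} .$$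
   Context: Linear regression model: $y_i=x_i\beta^*+\varepsilon_i$ for $i=1,\dots,n$, where the row vectors $x_i\in\mathbb{R}^p$ are deterministic, $\beta^*\in\mathbb{R}^p$ is an unknown parameter, and $\varepsilon_1,\dots,\varepsilon_n$ are i.i.d. centered Gaussian random variables with known variance $\sigma^2$. $X$ is the $n\times p$ matrix with $i$-th row $x_i$, normalized so that every column $X_j$ satisfies $X_j'X_j/n=1$; $Y=(y_1,\dots,y_n)'$. A prime denotes transpose. $\|v\|_1$, $\|v\|_2$, $\|v\|_\infty$ are the usual $\ell_1$, $\ell_2$, $\ell_\infty$ norms and $\|v\|_0$ is the number of nonzero coordinates of $v$. *)

theory Defs
  imports "HOL-Probability.Probability"
begin

definition l1norm :: "real ^ 'm \<Rightarrow> real" where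
  "l1norm v = (\<Sum>j\<in>UNIV. \<bar>v $ j\<bar>)"

definition l0norm :: "real ^ 'm \<Rightarrow> nat" where
  "l0norm v = card {j. v $ j \<noteq> 0}"

text \<open>``With probability at least \<open>q\<close>, \<open>P\<close> holds''.  The set where \<open>P\<close> holds is only required
  to contain an event of probability at least \<open>q\<close>, because \<open>P\<close> may involve a minimizer
  that is not unique and not chosen measurably.  For measurable sets this is the usual
  meaning, by the lemma below.\<close>
definition with_prob_at_least :: "'a measure \<Rightarrow> real \<Rightarrow> ('a \<Rightarrow> bool) \<Rightarrow> bool" where
  "with_prob_at_least M q P \<longleftrightarrow> (\<exists>E\<in>sets M. measure M E \<ge> q \<and> (\<forall>\<omega>\<in>E. P \<omega>))"

lemma with_prob_at_least_iff:
  assumes "prob_space M" and meas: "{\<omega> \<in> space M. P \<omega>} \<in> sets M"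
  shows "with_prob_at_least M q P \<longleftrightarrow> measure M {\<omega> \<in> space M. P \<omega>} \<ge> q"
proof -
  interpret prob_space M by fact
  show ?thesis
  proof
    assume "with_prob_at_least M q P"
    then obtain E where E: "E \<in> sets M" "measure M E \<ge> q" "\<forall>\<omega>\<in>E. P \<omega>"
      unfolding with_prob_at_least_def by blast
    have "E \<subseteq> {\<omega> \<in> space M. P \<omega>}"
      using E(1,3) sets.sets_into_space by blast
    then have "measure M E \<le> measure M {\<omega> \<in> space M. P \<omega>}"
      using meas by (rule finite_measure_mono)
    with E(2) show "measure M {\<omega> \<in> space M. P \<omega>} \<ge> q" by linarith
  next
    assume "measure M {\<omega> \<in> space M. P \<omega>} \<ge> q"
    with meas show "with_prob_at_least M q P"
      unfolding with_prob_at_least_def by blast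
  qed
qed

end

(*
  On the event where the preliminary estimator is accurate, Hoelder's inequality bounds the linear
  term of the Lasso criterion by lam * |h|_1, with h the estimation error.  Comparing the criterion
  at the minimizer and at the true parameter then gives |A h|^2 + lam * |h_{S^c}|_1 <= 3 * lam * |h_S|_1,
  S being the true support.  So h lies in the cone of the restricted eigenvalue condition, and together
  with Cauchy-Schwarz on S this bounds |h_S|_1, hence both losses.
*)
theory Submission
  imports Defs
begin

lemma abs_inner_le_infnorm_l1norm:
  fixes u v :: "real ^ 'p"
  shows "\<bar>u \<bullet> v\<bar> \<le> infnorm u * l1norm v"
proof -
  have "\<bar>u \<bullet> v\<bar> \<le> (\<Sum>j\<in>UNIV. \<bar>u $ j\<bar> * \<bar>v $ j\<bar>)"
    by (simp add: inner_vec_def flip: abs_mult)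
  also have "\<dots> \<le> (\<Sum>j\<in>UNIV. infnorm u * \<bar>v $ j\<bar>)"
    by (intro sum_mono mult_right_mono component_le_infnorm_cart) simp
  finally show ?thesis
    by (simp add: l1norm_def sum_distrib_left)
qed

lemma sum_support_split:
  fixes \<beta> :: "real ^ 'p" and f :: "'p \<Rightarrow> real"
  shows "(\<Sum>j\<in>UNIV. f j) = (\<Sum>j | \<beta> $ j \<noteq> 0. f j) + (\<Sum>j | \<beta> $ j = 0. f j)"
  by (subst sum.union_disjoint [symmetric]) (auto intro: sum.cong)

text \<open>Coordinatewise: on the support of \<open>\<beta>\<close> this is the reverse triangle
  inequality. Off the support \<open>\<beta> $ j\<close> vanishes, so the summand is exactly
  \<open>- \<bar>b $ j\<bar>\<close>, and errors there are paid for in full by the penalty.\<close>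

lemma l1norm_diff_le_support:
  fixes \<beta> b :: "real ^ 'p"
  shows "l1norm \<beta> - l1norm b
    \<le> (\<Sum>j | \<beta> $ j \<noteq> 0. \<bar>(b - \<beta>) $ j\<bar>) - (\<Sum>j | \<beta> $ j = 0. \<bar>(b - \<beta>) $ j\<bar>)"
proof -
  have "l1norm \<beta> - l1norm b = (\<Sum>j\<in>UNIV. \<bar>\<beta> $ j\<bar> - \<bar>b $ j\<bar>)"
    by (simp add: l1norm_def sum_subtractf)
  also have "\<dots> = (\<Sum>j | \<beta> $ j \<noteq> 0. \<bar>\<beta> $ j\<bar> - \<bar>b $ j\<bar>) + (\<Sum>j | \<beta> $ j = 0. \<bar>\<beta> $ j\<bar> - \<bar>b $ j\<bar>)"
    by (rule sum_support_split)
  also have "\<dots> \<le> (\<Sum>j | \<beta> $ j \<noteq> 0. \<bar>(b - \<beta>) $ j\<bar>) + (\<Sum>j | \<beta> $ j = 0. - \<bar>(b - \<beta>) $ j\<bar>)"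
    by (intro add_mono sum_mono) auto
  finally show ?thesis
    by (simp add: sum_negf)
qed

text \<open>Purely deterministic: \<open>z\<close> is one realization of the preliminary estimator,
  and \<open>le\<close> compares the criterion at \<open>b\<close> with its value at
  \<open>\<beta>\<close>. The score bound \<open>lam / 2\<close> leaves the noise half the weight
  \<open>2 * lam\<close> of the penalty, so part of the penalty survives off the support.\<close>

lemma lasso_basic_inequality:
  fixes A :: "real ^ 'p ^ 'q" and \<beta> b :: "real ^ 'p"
  assumes "0 \<le> lam"
    and score: "infnorm (transpose A *v (z - A *v \<beta>)) \<le> lam / 2"
    and le: "(norm (z - A *v b))\<^sup>2 + 2 * lam * l1norm b \<le> (norm (z - A *v \<beta>))\<^sup>2 + 2 * lam * l1norm \<beta>"
  shows "(norm (A *v (b - \<beta>)))\<^sup>2 + lam * (\<Sum>j | \<beta> $ j = 0. \<bar>(b - \<beta>) $ j\<bar>)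
    \<le> 3 * lam * (\<Sum>j | \<beta> $ j \<noteq> 0. \<bar>(b - \<beta>) $ j\<bar>)"
proof -
  define h r where "h = b - \<beta>" and "r = z - A *v \<beta>"
  have "z - A *v b = r - A *v h"
    by (simp add: h_def r_def matrix_vector_mult_diff_distrib)
  then have "(norm (z - A *v b))\<^sup>2 = (norm r)\<^sup>2 - 2 * (r \<bullet> (A *v h)) + (norm (A *v h))\<^sup>2"
    by (simp add: power2_norm_eq_inner inner_diff inner_commute)
  moreover have "r \<bullet> (A *v h) = (transpose A *v r) \<bullet> h"
    by (simp add: dot_lmul_matrix transpose_matrix_vector)
  moreover have "(transpose A *v r) \<bullet> h \<le> lam / 2 * l1norm h"
  proof -
    have "(transpose A *v r) \<bullet> h \<le> infnorm (transpose A *v r) * l1norm h"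
      using abs_inner_le_infnorm_l1norm [of "transpose A *v r" h] by linarith
    also have "\<dots> \<le> lam / 2 * l1norm h"
      using score by (intro mult_right_mono) (auto simp: r_def l1norm_def sum_nonneg)
    finally show ?thesis .
  qed
  \<comment> \<open>The term \<open>(norm r)\<^sup>2\<close> occurs on both sides of
    \<open>le\<close> and cancels. The cross term carries a factor 2, which turns
    \<open>lam / 2\<close> into \<open>lam\<close>.\<close>
  ultimately have "(norm (A *v h))\<^sup>2 \<le> lam * l1norm h + 2 * (lam * (l1norm \<beta> - l1norm b))"
    using le by (simp add: r_def algebra_simps)
  also have "\<dots> \<le> lam * l1norm h
      + 2 * (lam * ((\<Sum>j | \<beta> $ j \<noteq> 0. \<bar>h $ j\<bar>) - (\<Sum>j | \<beta> $ j = 0. \<bar>h $ j\<bar>)))"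
    using mult_left_mono [OF l1norm_diff_le_support [of \<beta> b] \<open>0 \<le> lam\<close>] by (simp add: h_def)
  \<comment> \<open>Splitting \<open>l1norm h\<close> over the support, the coefficients of
    \<open>lam\<close> are 1 + 2 = 3 on it and 1 - 2 = -1 off it. This is the source of the cone
    constant 3.\<close>
  finally show ?thesis
    by (simp add: h_def l1norm_def sum_support_split [of _ \<beta>] algebra_simps)
qed

text \<open>Here \<open>k\<close> stands for the whole restricted eigenvalue constant, later
  \<open>c * n\<close>. Both losses reduce to a bound on \<open>t\<close>, the l1 error on the
  support: the prediction loss is at most \<open>3 * lam * t\<close> and the l1 loss at most
  \<open>4 * t\<close>.\<close>

lemma lasso_oracle_inequality:
  fixes A :: "real ^ 'p ^ 'q" and \<beta> b :: "real ^ 'p"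
  assumes "0 < lam" "0 < k"
    and restricted_eigenvalue:
      "\<And>\<alpha> :: real ^ 'p.
         (\<Sum>j | \<beta> $ j = 0. \<bar>\<alpha> $ j\<bar>) \<le> 3 * (\<Sum>j | \<beta> $ j \<noteq> 0. \<bar>\<alpha> $ j\<bar>) \<Longrightarrow>
         \<alpha> \<bullet> ((transpose A ** A) *v \<alpha>) \<ge> k * (\<Sum>j | \<beta> $ j \<noteq> 0. (\<alpha> $ j)\<^sup>2)"
    and score: "infnorm (transpose A *v (z - A *v \<beta>)) \<le> lam / 2"
    and le: "(norm (z - A *v b))\<^sup>2 + 2 * lam * l1norm b \<le> (norm (z - A *v \<beta>))\<^sup>2 + 2 * lam * l1norm \<beta>"
  shows "(norm (A *v (b - \<beta>)))\<^sup>2 \<le> 9 * lam\<^sup>2 * l0norm \<beta> / k"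
    and "l1norm (\<beta> - b) \<le> 12 * lam * l0norm \<beta> / k"
proof -
  define h where "h = b - \<beta>"
  define t u where "t = (\<Sum>j | \<beta> $ j \<noteq> 0. \<bar>h $ j\<bar>)" and "u = (\<Sum>j | \<beta> $ j = 0. \<bar>h $ j\<bar>)"
  have nonneg: "0 \<le> t" "0 \<le> u"
    by (simp_all add: t_def u_def sum_nonneg)
  have basic: "(norm (A *v h))\<^sup>2 + lam * u \<le> 3 * lam * t"
    using lasso_basic_inequality [OF _ score le] \<open>0 < lam\<close> by (simp add: h_def t_def u_def)
  moreover have "0 \<le> lam * u"
    using nonneg \<open>0 < lam\<close> by simp
  ultimately have norm_le: "(norm (A *v h))\<^sup>2 \<le> 3 * lam * t"
    by linarith
  from basic have "lam * u \<le> lam * (3 * t)"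
    using zero_le_power2 [of "norm (A *v h)"] by linarith
  then have cone: "u \<le> 3 * t"
    using \<open>0 < lam\<close> by simp
  have "h \<bullet> ((transpose A ** A) *v h) = (norm (A *v h))\<^sup>2"
    using dot_lmul_matrix [of "A *v h" A h]
    by (simp add: power2_norm_eq_inner inner_commute [of h] transpose_matrix_vector
        flip: matrix_vector_mul_assoc)
  with restricted_eigenvalue [of h] cone
  have re: "k * (\<Sum>j | \<beta> $ j \<noteq> 0. (h $ j)\<^sup>2) \<le> (norm (A *v h))\<^sup>2"
    by (simp add: t_def u_def)
  \<comment> \<open>Cauchy-Schwarz against the constant 1 on the support, whose cardinality is
    \<open>l0norm \<beta>\<close>.\<close>
  have "t\<^sup>2 \<le> l0norm \<beta> * (\<Sum>j | \<beta> $ j \<noteq> 0. (h $ j)\<^sup>2)"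
    using sum_squared_le_sum_of_squares [of "\<lambda>j. \<bar>h $ j\<bar>" "{j. \<beta> $ j \<noteq> 0}"]
    by (simp add: t_def l0norm_def mult.commute)
  then have "k * t\<^sup>2 \<le> l0norm \<beta> * (k * (\<Sum>j | \<beta> $ j \<noteq> 0. (h $ j)\<^sup>2))"
    using mult_left_mono [of "t\<^sup>2" _ k] \<open>0 < k\<close> by (simp add: mult.left_commute)
  also have "\<dots> \<le> l0norm \<beta> * (norm (A *v h))\<^sup>2"
    using re by (intro mult_left_mono) simp_all
  also have "\<dots> \<le> l0norm \<beta> * (3 * lam * t)"
    using norm_le by (intro mult_left_mono) simp_all
  \<comment> \<open>The left side is quadratic in \<open>t\<close> and the right side linear, so one
    factor \<open>t\<close> cancels; for \<open>t = 0\<close> the resulting bound is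
    trivial.\<close>
  finally have "(k * t) * t \<le> (3 * lam * l0norm \<beta>) * t"
    by (simp add: power2_eq_square algebra_simps)
  then have "k * t \<le> 3 * lam * l0norm \<beta>"
    using nonneg \<open>0 < lam\<close> by (cases "t = 0") (auto simp: mult_le_cancel_right)
  then have t_le: "t \<le> 3 * lam * l0norm \<beta> / k"
    using \<open>0 < k\<close> by (simp add: field_simps)
  have "3 * lam * t \<le> 3 * lam * (3 * lam * l0norm \<beta> / k)"
    using t_le \<open>0 < lam\<close> by (intro mult_left_mono) simp_all
  also have "\<dots> = 9 * lam\<^sup>2 * l0norm \<beta> / k"
    by (simp add: power2_eq_square)
  finally show "(norm (A *v (b - \<beta>)))\<^sup>2 \<le> 9 * lam\<^sup>2 * l0norm \<beta> / k"
    using norm_le by (simp add: h_def)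
  have "l1norm (\<beta> - b) = t + u"
    by (simp add: l1norm_def h_def t_def u_def sum_support_split [of _ \<beta>] abs_minus_commute)
  also have "\<dots> \<le> 4 * (3 * lam * l0norm \<beta> / k)"
    using cone t_le by linarith
  finally show "l1norm (\<beta> - b) \<le> 12 * lam * l0norm \<beta> / k"
    by simp
qed

theorem theorem4p3:
  fixes M :: "'w measure"
    and X :: "real ^ 'p ^ 'n"
    and \<beta>s :: "real ^ 'p"
    and \<epsilon> :: "'n \<Rightarrow> 'w \<Rightarrow> real"
    and Y :: "'w \<Rightarrow> real ^ 'n"
    and A :: "real ^ 'p ^ 'q"
    and Ahat :: "'w \<Rightarrow> real ^ 'q"
    and \<beta>hat :: "'w \<Rightarrow> real ^ 'p"
    and \<sigma> \<kappa> \<eta> c lam :: real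
  assumes prob: "prob_space M"
    and sigma: "\<sigma> > 0"
    and columns: "\<And>j. (column j X \<bullet> column j X) / CARD('n) = 1"
    and noise_indep: "prob_space.indep_vars M (\<lambda>_. borel) \<epsilon> UNIV"
    and noise_gauss: "\<And>i. distributed M lborel (\<epsilon> i) (normal_density 0 \<sigma>)"
    and model: "\<And>\<omega> i. \<omega> \<in> space M \<Longrightarrow> Y \<omega> $ i = row i X \<bullet> \<beta>s + \<epsilon> i \<omega>"
    and Ahat: "Ahat \<in> borel_measurable M"
    and kappa: "\<kappa> > 0"
    and eta: "0 < \<eta>" "\<eta> < 1"
    and c_pos: "c > 0"
    and restricted_eigenvalue:
      "\<And>\<alpha> :: real ^ 'p.
         (\<Sum>j | \<beta>s $ j = 0. \<bar>\<alpha> $ j\<bar>) \<le> 3 * (\<Sum>j | \<beta>s $ j \<noteq> 0. \<bar>\<alpha> $ j\<bar>) \<Longrightarrow>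
         \<alpha> \<bullet> ((transpose A ** A) *v \<alpha>) \<ge> c * CARD('n) * (\<Sum>j | \<beta>s $ j \<noteq> 0. (\<alpha> $ j)\<^sup>2)"
    and preliminary:
      "with_prob_at_least M (1 - \<eta>)
         (\<lambda>\<omega>. infnorm (transpose A *v (Ahat \<omega> - A *v \<beta>s)) \<le> \<kappa> * \<sigma> * sqrt (2 * CARD('n) * ln (CARD('p) / \<eta>)))"
    and lambda: "lam = 2 * \<kappa> * \<sigma> * sqrt (2 * CARD('n) * ln (CARD('p) / \<eta>))"
    and minimizer:
      "\<And>\<omega>. \<omega> \<in> space M \<Longrightarrow>
         is_arg_min (\<lambda>\<beta>. (norm (Ahat \<omega> - A *v \<beta>))\<^sup>2 + 2 * lam * l1norm \<beta>) (\<lambda>\<beta>. True) (\<beta>hat \<omega>)"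
  shows "with_prob_at_least M (1 - \<eta>)
           (\<lambda>\<omega>. (norm (A *v (\<beta>hat \<omega> - \<beta>s)))\<^sup>2
                    \<le> 72 * \<sigma>\<^sup>2 * \<kappa>\<^sup>2 * l0norm \<beta>s / c * ln (CARD('p) / \<eta>)
              \<and> l1norm (\<beta>s - \<beta>hat \<omega>)
                    \<le> 24 * sqrt 2 * \<kappa> * \<sigma> * l0norm \<beta>s / c * sqrt (ln (CARD('p) / \<eta>) / CARD('n)))"
proof -
  define L where "L = ln (CARD('p) / \<eta>)"
  define n where "n = real CARD('n)"
  have "n > 0"
    by (simp add: n_def)
  \<comment> \<open>Since \<eta> < 1 \<le> p, the logarithm \<open>L\<close> is strictly positive,
    hence so is \<open>lam\<close>, as the oracle inequality demands.\<close>
  have "1 \<le> real CARD('p)"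
    by (simp add: Suc_le_eq)
  with eta have "\<eta> < CARD('p)"
    by linarith
  with eta have "1 < CARD('p) / \<eta>"
    by (simp add: less_divide_eq)
  then have "L > 0"
    by (simp add: L_def)
  have lam: "lam = 2 * \<kappa> * \<sigma> * sqrt (2 * n * L)"
    using lambda by (simp add: L_def n_def)
  have "lam > 0"
    using lam kappa sigma \<open>n > 0\<close> \<open>L > 0\<close> by simp
  have "c * n > 0"
    using c_pos \<open>n > 0\<close> by simp
  \<comment> \<open>The factor \<open>n\<close> cancels the one in \<open>c * n\<close>, and 9 * 8 =
    72.\<close>
  have "lam\<^sup>2 = 8 * \<kappa>\<^sup>2 * \<sigma>\<^sup>2 * L * n"
    using \<open>n > 0\<close> \<open>L > 0\<close> by (simp add: lam power_mult_distrib)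
  then have pred: "9 * lam\<^sup>2 * l0norm \<beta>s / (c * n) = 72 * \<sigma>\<^sup>2 * \<kappa>\<^sup>2 * l0norm \<beta>s / c * L"
    using \<open>n > 0\<close> by simp
  \<comment> \<open>Exhibits a full factor \<open>n\<close> in \<open>lam\<close>, to cancel against
    \<open>c * n\<close>; what remains is the rate \<open>sqrt (L / n)\<close>, with constant 12 * 2
    = 24.\<close>
  have "n * sqrt (L / n) = sqrt n * sqrt L"
    using \<open>n > 0\<close> by (simp add: real_sqrt_divide real_div_sqrt flip: times_divide_eq_left)
  then have "lam = 2 * \<kappa> * \<sigma> * sqrt 2 * sqrt (L / n) * n"
    by (simp add: lam real_sqrt_mult mult.commute [of _ n])
  then have est: "12 * lam * l0norm \<beta>s / (c * n)
      = 24 * sqrt 2 * \<kappa> * \<sigma> * l0norm \<beta>s / c * sqrt (L / n)"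
    using \<open>n > 0\<close> by simp
  have "\<kappa> * \<sigma> * sqrt (2 * CARD('n) * ln (CARD('p) / \<eta>)) = lam / 2"
    by (simp add: lambda)
  then obtain E where E: "E \<in> sets M" "measure M E \<ge> 1 - \<eta>"
    and score: "\<And>\<omega>. \<omega> \<in> E \<Longrightarrow> infnorm (transpose A *v (Ahat \<omega> - A *v \<beta>s)) \<le> lam / 2"
    using preliminary unfolding with_prob_at_least_def by metis
  \<comment> \<open>Both bounds hold at every point of \<open>E\<close>, so the event given by
    \<open>preliminary\<close> itself witnesses the joint conclusion, with no loss of
    probability.\<close>
  have "(norm (A *v (\<beta>hat \<omega> - \<beta>s)))\<^sup>2 \<le> 9 * lam\<^sup>2 * l0norm \<beta>s / (c * n)
      \<and> l1norm (\<beta>s - \<beta>hat \<omega>) \<le> 12 * lam * l0norm \<beta>s / (c * n)" if "\<omega> \<in> E" for \<omega>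
  proof -
    have "\<omega> \<in> space M"
      using that E(1) sets.sets_into_space by blast
    then have "(norm (Ahat \<omega> - A *v \<beta>hat \<omega>))\<^sup>2 + 2 * lam * l1norm (\<beta>hat \<omega>)
        \<le> (norm (Ahat \<omega> - A *v \<beta>s))\<^sup>2 + 2 * lam * l1norm \<beta>s"
      using minimizer by (auto simp: is_arg_min_linorder)
    from lasso_oracle_inequality [OF \<open>lam > 0\<close> \<open>c * n > 0\<close> _ score [OF that] this]
    show ?thesis
      using restricted_eigenvalue by (simp add: n_def)
  qed
  then show ?thesis
    using E unfolding with_prob_at_least_def pred est unfolding L_def n_def by blast
qed

end
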